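(* Let $\rho_1,\rho_2:\mathcal{X}\to\mathbb{R}$ be sublinear expectations and $\alpha\in(0,1)$. Suppose that there exist a probability measure $K$ and two families of probability measures $\mathcal{P}$ and $\mathcal{Q}$ on $(\Omega,\mathcal{F})$ such that $P\ll K$ and $Q\ll K$ for all $P\in\mathcal{P}$, $Q\in\mathcal{Q}$. If for every $X\in\mathcal{X}$ $$\rho_1(X)=\sup_{P\in\mathcal{P}}E_P[X]\quad\text{and}\quad\rho_2(X)=\sup_{Q\in\mathcal{Q}}E_Q[X],$$ then there exists $X^*\in\mathcal{X}_\alpha$ such that $\bar\rho_2(X^* )=\max_{X\in\mathcal{X}_\alpha}\bar\rho_2(X)$.
   Context: $(\Omega,\mathcal{F})$ is a measurable space and $\mathcal{X}$ is the space of all bounded measurable real functions on it. A sublinear expectation is a map $\rho:\mathcal{X}\to\mathbb{R}$ that is monotone ($\rho(\xi_1)\ge\rho(\xi_2)$ if $\xi_1\ge\xi_2$), constant preserving ($\rho(c)=c$ for $c\in\mathbb{R}$), sub-additive and positively homogeneous ($\rho(\lambda\xi)=\lambda\rho(\xi)$ for $\lambda\ge0$). Its conjugate is $\bar\rho(X)=-\rho(-X)$. $\mathcal{X}_\alpha=\{X\in\mathcal{X}: 0\le X\le 1,\ \rho_1(X)\le\alpha\}$. *)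

theory Defs
  imports "HOL-Probability.Probability"
begin

(* The measurable space is the pair (space M, sets M); the measure component of M is never used.
   Functions are total on the type 'a, so boundedness and the pointwise order are taken on
   space M only. Functions that agree on space M represent the same random variable, and the
   monotonicity clause of sublinear_expectation forces the same value on them. *)

definition bounded_measurable :: "'a measure \<Rightarrow> ('a \<Rightarrow> real) set" where
  "bounded_measurable M = {X \<in> borel_measurable M. bounded (X ` space M)}"

definition sublinear_expectation :: "'a measure \<Rightarrow> (('a \<Rightarrow> real) \<Rightarrow> real) \<Rightarrow> bool" where
  "sublinear_expectation M \<rho> \<longleftrightarrow>
     (\<forall>X \<in> bounded_measurable M. \<forall>Y \<in> bounded_measurable M.
        (\<forall>\<omega> \<in> space M. X \<omega> \<ge> Y \<omega>) \<longrightarrow> \<rho> X \<ge> \<rho> Y) \<and>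
     (\<forall>c. \<rho> (\<lambda>_. c) = c) \<and>
     (\<forall>X \<in> bounded_measurable M. \<forall>Y \<in> bounded_measurable M.
        \<rho> (\<lambda>\<omega>. X \<omega> + Y \<omega>) \<le> \<rho> X + \<rho> Y) \<and>
     (\<forall>X \<in> bounded_measurable M. \<forall>c \<ge> 0. \<rho> (\<lambda>\<omega>. c * X \<omega>) = c * \<rho> X)"

definition conjugate_expectation :: "(('a \<Rightarrow> real) \<Rightarrow> real) \<Rightarrow> ('a \<Rightarrow> real) \<Rightarrow> real" where
  "conjugate_expectation \<rho> X = - \<rho> (\<lambda>\<omega>. - X \<omega>)"

definition level_tests :: "'a measure \<Rightarrow> (('a \<Rightarrow> real) \<Rightarrow> real) \<Rightarrow> real \<Rightarrow> ('a \<Rightarrow> real) set" where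
  "level_tests M \<rho> \<alpha> =
     {X \<in> bounded_measurable M. (\<forall>\<omega> \<in> space M. 0 \<le> X \<omega> \<and> X \<omega> \<le> 1) \<and> \<rho> X \<le> \<alpha>}"

definition prob_measures_on :: "'a measure \<Rightarrow> 'a measure set" where
  "prob_measures_on M = {P. prob_space P \<and> sets P = sets M}"

end

theory Submission
  imports Defs
begin

text \<open>
  For level n, the tests whose power is within 1/(n+1) of the supremum form a convex set.  Choosing
  in each of these decreasing sets a test of almost minimal norm in L2(K), the parallelogram law
  yields an L2(K)-Cauchy sequence, so a subsequence converges K-almost everywhere.  All measures
  involved are dominated by K, so dominated convergence carries the bounds on both expectations
  over to the limit, which is therefore optimal.
\<close>

section \<open>Almost everywhere convergence from nearly minimal second moments\<close>

text \<open>The least second moment over \<open>A n\<close> can only grow as the sets shrink, and it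
  stays below \<open>B * B\<close>, so it converges. The parallelogram law turns its small
  increments into small distances between near-minimisers; midpoints are the only convex
  combinations that this law involves.\<close>

lemma (in prob_space) decseq_convex_AE_Cauchy:
  fixes A :: "nat \<Rightarrow> ('a \<Rightarrow> real) set"
  assumes decA: "decseq A" and ne: "\<And>n. A n \<noteq> {}"
    and meas: "\<And>n X. X \<in> A n \<Longrightarrow> X \<in> borel_measurable M"
    and bnd: "\<And>n X \<omega>. X \<in> A n \<Longrightarrow> \<omega> \<in> space M \<Longrightarrow> \<bar>X \<omega>\<bar> \<le> B"
    and mid: "\<And>n X Y. X \<in> A n \<Longrightarrow> Y \<in> A n \<Longrightarrow> (\<lambda>\<omega>. (1/2) * X \<omega> + (1/2) * Y \<omega>) \<in> A n"
  obtains Y where "\<And>n. Y n \<in> A n" "AE \<omega> in M. Cauchy (\<lambda>n. Y n \<omega>)"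
proof -
  let ?N = "\<lambda>X. \<integral>\<omega>. (X \<omega>)\<^sup>2 \<partial>M"
  define d where "d n = (INF X\<in>A n. ?N X)" for n
  have int: "integrable M X" if "X \<in> A n" for X n
    using that by (intro integrable_const_bound[where B=B] AE_I2) (auto intro: bnd meas)
  have int2: "integrable M (\<lambda>\<omega>. X \<omega> * Y \<omega>)" if "X \<in> A n" "Y \<in> A m" for X Y n m
  proof (rule integrable_const_bound[where B="B * B"])
    show "AE \<omega> in M. norm (X \<omega> * Y \<omega>) \<le> B * B"
    proof (rule AE_I2)
      fix \<omega> assume "\<omega> \<in> space M"
      with that show "norm (X \<omega> * Y \<omega>) \<le> B * B"
        by (auto simp: abs_mult intro!: mult_mono bnd order_trans[OF abs_ge_zero bnd])
    qed
    show "(\<lambda>\<omega>. X \<omega> * Y \<omega>) \<in> borel_measurable M"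
      using meas[OF that(1)] meas[OF that(2)] by (rule borel_measurable_times)
  qed
  have bdd: "bdd_below (?N ` A n)" for n
    by (rule bdd_belowI[where m=0]) auto
  have d_le: "d n \<le> ?N X" if "X \<in> A n" for n X
    unfolding d_def using that bdd by (rule cINF_lower[rotated])
  have d_mono: "d m \<le> d n" if "m \<le> n" for m n
    unfolding d_def using decseqD[OF decA that] ne bdd by (intro cINF_superset_mono) auto
  have d_bound: "d n \<le> B * B" for n
  proof -
    obtain X where X: "X \<in> A n" using ne by blast
    have "?N X \<le> (\<integral>\<omega>. B * B \<partial>M)"
    proof (rule integral_mono)
      show "integrable M (\<lambda>\<omega>. (X \<omega>)\<^sup>2)"
        using int2[OF X X] by (simp add: power2_eq_square)
      fix \<omega> assume "\<omega> \<in> space M"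
      then have "\<bar>X \<omega>\<bar> * \<bar>X \<omega>\<bar> \<le> B * B"
        by (intro mult_mono) (auto intro: bnd[OF X] order_trans[OF abs_ge_zero bnd[OF X]])
      then show "(X \<omega>)\<^sup>2 \<le> B * B" by (simp add: power2_eq_square)
    qed simp
    with d_le[OF X] show ?thesis by (simp add: prob_space)
  qed
  have "convergent d"
    using d_mono d_bound by (intro Bseq_mono_convergent incseq_bounded) (auto simp: incseq_def)
  then have Cd: "Cauchy d" by (rule convergent_Cauchy)
  \<comment> \<open>\<open>A n\<close> is not assumed closed, so the infimum may not be attained; a
    slack tending to 0 replaces exact minimality.\<close>
  have "\<exists>X\<in>A n. ?N X < d n + 1 / Suc n" for n
    using cINF_less_iff[OF ne bdd, of n "d n + 1 / Suc n"] by (simp add: d_def)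
  then obtain Z where Z: "\<And>n. Z n \<in> A n" "\<And>n. ?N (Z n) < d n + 1 / Suc n"
    by metis
  have diff: "(\<integral>\<omega>. \<bar>Z n \<omega> - Z m \<omega>\<bar> \<partial>M)\<^sup>2 \<le> 2 * (d m - d n) + 4 / Suc n" if "n \<le> m" for n m
  proof -
    \<comment> \<open>Both functions now lie in the larger set \<open>A n\<close>, hence so does
      their midpoint, whose second moment is therefore at least \<open>d n\<close>.\<close>
    have Zm: "Z m \<in> A n" using Z(1)[of m] decseqD[OF decA that] by auto
    note ints [simp] = int2[OF Z(1) Z(1)]
    have sq [simp]: "integrable M (\<lambda>\<omega>. (Z n \<omega> - Z m \<omega>)\<^sup>2)"
      by (simp add: power2_eq_square algebra_simps)
    \<comment> \<open>Nonnegative variance bounds the squared L1 distance by the squared L2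
      distance. The L1 form is the one from which an almost everywhere Cauchy subsequence is
      extracted later.\<close>
    have "0 \<le> variance (\<lambda>\<omega>. \<bar>Z n \<omega> - Z m \<omega>\<bar>)" by (rule variance_positive)
    also have "\<dots> = ?N (\<lambda>\<omega>. \<bar>Z n \<omega> - Z m \<omega>\<bar>) - (\<integral>\<omega>. \<bar>Z n \<omega> - Z m \<omega>\<bar> \<partial>M)\<^sup>2"
      by (rule variance_eq) (auto intro!: int[OF Z(1)])
    finally have "(\<integral>\<omega>. \<bar>Z n \<omega> - Z m \<omega>\<bar> \<partial>M)\<^sup>2 \<le> (\<integral>\<omega>. (Z n \<omega> - Z m \<omega>)\<^sup>2 \<partial>M)" by simp
    \<comment> \<open>The parallelogram law, pointwise, with the sum written as twice the
      midpoint.\<close>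
    also have "\<dots> = (\<integral>\<omega>. 2 * (Z n \<omega>)\<^sup>2 + 2 * (Z m \<omega>)\<^sup>2
        - 4 * ((1/2) * Z n \<omega> + (1/2) * Z m \<omega>)\<^sup>2 \<partial>M)"
      by (rule Bochner_Integration.integral_cong) (auto simp: power2_eq_square algebra_simps)
    also have "\<dots> = 2 * ?N (Z n) + 2 * ?N (Z m)
        - 4 * ?N (\<lambda>\<omega>. (1/2) * Z n \<omega> + (1/2) * Z m \<omega>)"
      using int2[OF mid[OF Z(1) Zm] mid[OF Z(1) Zm]]
      by (simp add: power2_eq_square)
    also have "\<dots> \<le> 2 * (d n + 1 / Suc n) + 2 * (d m + 1 / Suc m) - 4 * d n"
      by (intro diff_mono add_mono mult_left_mono d_le[OF mid[OF Z(1) Zm]]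
          less_imp_le[OF Z(2)]) simp_all
    \<comment> \<open>As \<open>n \<le> m\<close>, the slack of \<open>Z m\<close> is at most that
      of \<open>Z n\<close>, so the two merge into one term.\<close>
    also have "\<dots> \<le> 2 * (d m - d n) + 4 / Suc n"
    proof -
      have "2 * (a + x) + 2 * (b + y) - 4 * a \<le> 2 * (b - a) + 4 * x" if "y \<le> x"
        for a b x y :: real
        using that by simp
      from this[of "1 / Suc m" "1 / Suc n" "d n" "d m"] show ?thesis
        using that by (simp add: frac_le)
    qed
    finally show ?thesis .
  qed
  have "\<exists>N. \<forall>i\<ge>N. \<forall>j\<ge>N. (LINT \<omega>|M. norm (Z i \<omega> - Z j \<omega>)) < e" if e: "e > 0" for e
  proof -
    \<comment> \<open>The bound \<open>diff\<close> has weights 2 and 4, so tolerances of one eighth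
      add up to 6/8 of the square of \<open>e\<close>.\<close>
    have e2: "e\<^sup>2 / 8 > 0" using e by simp
    obtain N1 where N1: "\<forall>m\<ge>N1. \<forall>n\<ge>N1. norm (d m - d n) < e\<^sup>2 / 8"
      using CauchyD[OF Cd e2] by blast
    obtain N2 where N2: "1 / real (Suc N2) < e\<^sup>2 / 8"
      using nat_approx_posE[OF e2] by blast
    \<comment> \<open>\<open>diff\<close> needs ordered indices; the other order follows by symmetry
      of the distance.\<close>
    have *: "(LINT \<omega>|M. \<bar>Z i \<omega> - Z j \<omega>\<bar>) < e" if "max N1 N2 \<le> i" "i \<le> j" for i j
    proof -
      have "\<bar>d j - d i\<bar> < e\<^sup>2 / 8" using N1 that by (metis max.bounded_iff order_trans real_norm_def)
      with abs_ge_self have "d j - d i < e\<^sup>2 / 8" by (rule order_le_less_trans)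
      moreover have "1 / real (Suc i) < e\<^sup>2 / 8"
        using that by (intro le_less_trans[OF _ N2] divide_left_mono) auto
      ultimately have "2 * (d j - d i) + 4 * (1 / real (Suc i)) < 2 * (e\<^sup>2 / 8) + 4 * (e\<^sup>2 / 8)"
        by (intro add_strict_mono mult_strict_left_mono) simp_all
      also have "\<dots> \<le> e\<^sup>2" by simp
      finally have "(LINT \<omega>|M. \<bar>Z i \<omega> - Z j \<omega>\<bar>)\<^sup>2 < e\<^sup>2"
        using diff[OF that(2)] by (simp add: order_le_less_trans)
      then show ?thesis using e by (simp add: power_less_imp_less_base)
    qed
    show ?thesis
    proof (intro exI[of _ "max N1 N2"] allI impI)
      fix i j assume ij: "max N1 N2 \<le> i" "max N1 N2 \<le> j"
      show "(LINT \<omega>|M. norm (Z i \<omega> - Z j \<omega>)) < e"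
        using *[of i j] *[of j i] ij by (cases "i \<le> j") (auto simp: abs_minus_commute)
    qed
  qed
  then obtain r where r: "strict_mono r" "AE \<omega> in M. Cauchy (\<lambda>i. Z (r i) \<omega>)"
    using cauchy_L1_AE_cauchy_subseq[of M Z] int[OF Z(1)] by metis
  show thesis
  proof
    show "Z (r n) \<in> A n" for n
      \<comment> \<open>A strictly increasing \<open>r\<close> satisfies \<open>n \<le> r n\<close>,
        so passing to the subsequence only moves into smaller sets.\<close>
      using Z(1)[of "r n"] decseqD[OF decA seq_suble[OF r(1), of n]] by auto
  qed (rule r(2))
qed

section \<open>Bounded measurable functions and sublinear expectations\<close>

lemma sublinear_expectationD:
  assumes "sublinear_expectation M \<rho>"
  shows sublinear_mono: "\<lbrakk>X \<in> bounded_measurable M; Y \<in> bounded_measurable M;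
      \<And>\<omega>. \<omega> \<in> space M \<Longrightarrow> Y \<omega> \<le> X \<omega>\<rbrakk> \<Longrightarrow> \<rho> Y \<le> \<rho> X"
    and sublinear_const: "\<rho> (\<lambda>_. c) = c"
    and sublinear_add: "\<lbrakk>X \<in> bounded_measurable M; Y \<in> bounded_measurable M\<rbrakk>
      \<Longrightarrow> \<rho> (\<lambda>\<omega>. X \<omega> + Y \<omega>) \<le> \<rho> X + \<rho> Y"
    and sublinear_scale: "\<lbrakk>X \<in> bounded_measurable M; 0 \<le> a\<rbrakk> \<Longrightarrow> \<rho> (\<lambda>\<omega>. a * X \<omega>) = a * \<rho> X"
  using assms unfolding sublinear_expectation_def by blast+

lemma bounded_measurableI:
  assumes "X \<in> borel_measurable M" "\<And>\<omega>. \<omega> \<in> space M \<Longrightarrow> \<bar>X \<omega>\<bar> \<le> B"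
  shows "X \<in> bounded_measurable M"
  using assms by (auto simp: bounded_measurable_def bounded_iff)

lemma bounded_measurableE:
  assumes "X \<in> bounded_measurable M"
  obtains B where "X \<in> borel_measurable M" "\<And>\<omega>. \<omega> \<in> space M \<Longrightarrow> \<bar>X \<omega>\<bar> \<le> B"
  using assms by (auto simp: bounded_measurable_def bounded_iff)

lemma bounded_measurable_scale:
  assumes "X \<in> bounded_measurable M"
  shows "(\<lambda>\<omega>. a * X \<omega>) \<in> bounded_measurable M"
proof -
  obtain B where "X \<in> borel_measurable M" "\<And>\<omega>. \<omega> \<in> space M \<Longrightarrow> \<bar>X \<omega>\<bar> \<le> B"
    using bounded_measurableE[OF assms] by metis
  then show ?thesis
    by (intro bounded_measurableI[where B="\<bar>a\<bar> * B"]) (auto simp: abs_mult intro: mult_left_mono)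
qed

lemma bounded_measurable_add:
  assumes "X \<in> bounded_measurable M" "Y \<in> bounded_measurable M"
  shows "(\<lambda>\<omega>. X \<omega> + Y \<omega>) \<in> bounded_measurable M"
  using assms by (auto simp: bounded_measurable_def intro: bounded_plus_comp)

text \<open>Sub-additivity and positive homogeneity make sublevel sets convex. This serves both the
  size constraint on a test and, applied to negated tests, the lower bound on its power.\<close>

lemma sublinear_midpoint:
  assumes "sublinear_expectation M \<rho>" "X \<in> bounded_measurable M" "Y \<in> bounded_measurable M"
    and "\<rho> X \<le> c" "\<rho> Y \<le> c"
  shows "\<rho> (\<lambda>\<omega>. (1/2) * X \<omega> + (1/2) * Y \<omega>) \<le> c"
proof -
  have "\<rho> (\<lambda>\<omega>. (1/2) * X \<omega> + (1/2) * Y \<omega>) \<le> \<rho> (\<lambda>\<omega>. (1/2) * X \<omega>) + \<rho> (\<lambda>\<omega>. (1/2) * Y \<omega>)"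
    by (intro sublinear_add[OF assms(1)] bounded_measurable_scale assms)
  also have "\<dots> = (1/2) * \<rho> X + (1/2) * \<rho> Y"
    by (simp only: sublinear_scale[OF assms(1,2)] sublinear_scale[OF assms(1,3)])
  finally show ?thesis using assms(4,5) by linarith
qed

section \<open>Suprema of expectations over a dominated family\<close>

text \<open>The bound does not depend on \<open>P\<close>, so it shows that a family of expectations
  is bounded above, without which a real \<open>SUP\<close> says nothing.\<close>

lemma integral_le_of_bound:
  fixes X :: "'a \<Rightarrow> real"
  assumes "P \<in> prob_measures_on M" "X \<in> borel_measurable M"
    and "\<And>\<omega>. \<omega> \<in> space M \<Longrightarrow> \<bar>X \<omega>\<bar> \<le> B"
  shows "integral\<^sup>L P X \<le> B"
proof -
  interpret prob_space P using assms by (simp add: prob_measures_on_def)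
  have sets [measurable_cong]: "sets P = sets M" using assms by (simp add: prob_measures_on_def)
  have sp: "space P = space M" by (rule sets_eq_imp_space_eq[OF sets])
  have [measurable]: "X \<in> borel_measurable P" using assms by simp
  have "integrable P X"
    using assms by (intro integrable_const_bound[where B=B] AE_I2) (auto simp: sp)
  then show ?thesis
    using assms by (intro integral_le_const AE_I2) (auto simp: sp abs_le_iff)
qed

text \<open>A Fatou property: absolute continuity carries the convergence from \<open>K\<close> to
  each \<open>P\<close>, dominated convergence gives the limit of the expectations under that single
  \<open>P\<close>, and the supremum is taken last. Bounds \<open>c n\<close> varying with n cover
  both a fixed size and a power that is only asymptotically optimal.\<close>

lemma dominated_sup_expectation_limit_le:
  fixes M K :: "'a measure" and Y :: "nat \<Rightarrow> 'a \<Rightarrow> real"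
  assumes sub: "sublinear_expectation M \<rho>" and R: "R \<subseteq> prob_measures_on M"
    and K: "sets K = sets M" and ac: "\<And>P. P \<in> R \<Longrightarrow> absolutely_continuous K P"
    and rep: "\<And>X. X \<in> bounded_measurable M \<Longrightarrow> \<rho> X = (SUP P\<in>R. integral\<^sup>L P X)"
    and Y: "\<And>n. Y n \<in> borel_measurable M" "\<And>n \<omega>. \<omega> \<in> space M \<Longrightarrow> \<bar>Y n \<omega>\<bar> \<le> B"
    and Z: "Z \<in> bounded_measurable M" and lim: "AE \<omega> in K. (\<lambda>n. Y n \<omega>) \<longlonglongrightarrow> Z \<omega>"
    and le: "\<And>n. \<rho> (Y n) \<le> c n" and c: "c \<longlonglongrightarrow> l"
  shows "\<rho> Z \<le> l"
proof -
  \<comment> \<open>The supremum of the empty set is a fixed real number, which cannot preserve all constants.\<close>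
  have "R \<noteq> {}"
  proof
    assume [simp]: "R = {}"
    have "(\<lambda>_. a) \<in> bounded_measurable M" for a
      by (rule bounded_measurableI) auto
    from rep[OF this] sublinear_const[OF sub] have "a = Sup {}" for a :: real
      by simp
    from this[of 0] this[of 1] show False by simp
  qed
  have "integral\<^sup>L P Z \<le> l" if P: "P \<in> R" for P
  proof (rule LIMSEQ_le)
    have PM: "P \<in> prob_measures_on M" using P R by auto
    interpret prob_space P using PM by (simp add: prob_measures_on_def)
    have sets: "sets P = sets M" using PM by (simp add: prob_measures_on_def)
    have sp: "space P = space M" by (rule sets_eq_imp_space_eq[OF sets])
    have meas: "borel_measurable P = (borel_measurable M :: ('a \<Rightarrow> real) set)"
      by (rule measurable_cong_sets[OF sets refl])
    have "AE \<omega> in P. (\<lambda>n. Y n \<omega>) \<longlonglongrightarrow> Z \<omega>"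
      using absolutely_continuous_AE[OF _ ac[OF P] lim] sets K by simp
    then show "(\<lambda>n. integral\<^sup>L P (Y n)) \<longlonglongrightarrow> integral\<^sup>L P Z"
      using Z Y by (intro integral_dominated_convergence[where w="\<lambda>_. B"])
        (auto simp: meas sp bounded_measurable_def)
    show "c \<longlonglongrightarrow> l" by (rule c)
    have "integral\<^sup>L P (Y n) \<le> c n" for n
    proof -
      have "integral\<^sup>L P (Y n) \<le> (SUP P\<in>R. integral\<^sup>L P (Y n))"
        using R Y by (intro cSUP_upper[OF P] bdd_aboveI2[where M=B] integral_le_of_bound) auto
      also have "\<dots> = \<rho> (Y n)"
        by (rule rep[symmetric]) (rule bounded_measurableI[OF Y])
      finally show ?thesis using le[of n] by simp
    qed
    then show "\<exists>N. \<forall>n\<ge>N. integral\<^sup>L P (Y n) \<le> c n" by blast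
  qed
  then show ?thesis
    unfolding rep[OF Z] by (intro cSUP_least \<open>R \<noteq> {}\<close>)
qed

section \<open>Existence of an optimal test\<close>

theorem theorem4p2:
  fixes M K :: "'a measure"
    and \<rho>1 \<rho>2 :: "('a \<Rightarrow> real) \<Rightarrow> real"
    and \<alpha> :: real
    and \<P> \<Q> :: "'a measure set"
  assumes "sublinear_expectation M \<rho>1" and "sublinear_expectation M \<rho>2"
    and "0 < \<alpha>" and "\<alpha> < 1"
    and "K \<in> prob_measures_on M"
    and "\<P> \<subseteq> prob_measures_on M" and "\<Q> \<subseteq> prob_measures_on M"
    and "\<And>P. P \<in> \<P> \<Longrightarrow> absolutely_continuous K P"
    and "\<And>Q. Q \<in> \<Q> \<Longrightarrow> absolutely_continuous K Q"
    and "\<And>X. X \<in> bounded_measurable M \<Longrightarrow> \<rho>1 X = (SUP P\<in>\<P>. integral\<^sup>L P X)"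
    and "\<And>X. X \<in> bounded_measurable M \<Longrightarrow> \<rho>2 X = (SUP Q\<in>\<Q>. integral\<^sup>L Q X)"
  shows "\<exists>X' \<in> level_tests M \<rho>1 \<alpha>.
           \<forall>X \<in> level_tests M \<rho>1 \<alpha>.
             conjugate_expectation \<rho>2 X \<le> conjugate_expectation \<rho>2 X'"
proof -
  let ?L = "level_tests M \<rho>1 \<alpha>" and ?c = "conjugate_expectation \<rho>2"
  interpret prob_space K using assms(5) by (simp add: prob_measures_on_def)
  have sets [measurable_cong]: "sets K = sets M" using assms(5) by (simp add: prob_measures_on_def)
  have sp: "space K = space M" by (rule sets_eq_imp_space_eq[OF sets])
  have Lbm: "X \<in> bounded_measurable M" if "X \<in> ?L" for X
    using that by (simp add: level_tests_def)
  have Lm: "X \<in> borel_measurable M" if "X \<in> ?L" for X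
    using Lbm[OF that] by (simp add: bounded_measurable_def)
  have L01: "0 \<le> X \<omega>" "X \<omega> \<le> 1" if "X \<in> ?L" "\<omega> \<in> space M" for X \<omega>
    using that by (auto simp: level_tests_def)
  have neg: "(\<lambda>\<omega>. - X \<omega>) \<in> bounded_measurable M" if "X \<in> bounded_measurable M" for X
    using bounded_measurable_scale[OF that, of "-1"] by simp
  have const: "(\<lambda>_. a) \<in> bounded_measurable M" for a
    by (rule bounded_measurableI) auto
  define s where "s = Sup (?c ` ?L)"
  define A where "A n = {X \<in> ?L. s - 1 / Suc n \<le> ?c X}" for n
  \<comment> \<open>The zero test has size 0, which is below the positive level, so the supremum
    \<open>s\<close> is over a nonempty set.\<close>
  have "(\<lambda>_. 0) \<in> ?L"
    using const assms(3) sublinear_const[OF assms(1), of 0] by (simp add: level_tests_def)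
  then have ne: "?c ` ?L \<noteq> {}" by blast
  have bdd: "bdd_above (?c ` ?L)"
  proof (rule bdd_aboveI2)
    fix X assume X: "X \<in> ?L"
    have "\<rho>2 (\<lambda>_. - 1) \<le> \<rho>2 (\<lambda>\<omega>. - X \<omega>)"
      by (intro sublinear_mono[OF assms(2)] neg Lbm X const) (auto intro: L01[OF X])
    then show "?c X \<le> 1"
      by (simp add: conjugate_expectation_def sublinear_const[OF assms(2)])
  qed
  have "\<exists>Y. (\<forall>n. Y n \<in> A n) \<and> (AE \<omega> in K. Cauchy (\<lambda>n. Y n \<omega>))"
  proof (rule decseq_convex_AE_Cauchy[of A 1])
    show "decseq A"
    proof (rule decseq_SucI)
      fix n
      have "1 / real (Suc (Suc n)) \<le> 1 / real (Suc n)" by (simp add: field_simps)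
      then show "A (Suc n) \<subseteq> A n" by (auto simp: A_def)
    qed
    show "A n \<noteq> {}" for n
    proof -
      have "s - 1 / Suc n < s" by simp
      then obtain X where "X \<in> ?L" "s - 1 / Suc n < ?c X"
        unfolding s_def less_cSup_iff[OF ne bdd] by blast
      then show ?thesis by (auto simp: A_def intro: less_imp_le)
    qed
    show "X \<in> borel_measurable K" if "X \<in> A n" for n X
      using that Lm by (auto simp: A_def measurable_cong_sets[OF sets refl])
    show "\<bar>X \<omega>\<bar> \<le> 1" if "X \<in> A n" "\<omega> \<in> space K" for n X \<omega>
      using that L01[of X \<omega>] by (auto simp: A_def sp)
    show "(\<lambda>\<omega>. (1/2) * X \<omega> + (1/2) * Y \<omega>) \<in> A n" if "X \<in> A n" "Y \<in> A n" for n X Y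
    proof -
      have XY: "X \<in> ?L" "Y \<in> ?L" using that by (auto simp: A_def)
      have "\<rho>1 (\<lambda>\<omega>. (1/2) * X \<omega> + (1/2) * Y \<omega>) \<le> \<alpha>"
        using XY by (intro sublinear_midpoint[OF assms(1)]) (auto simp: level_tests_def)
      \<comment> \<open>A lower bound on the conjugate is an upper bound on \<open>\<rho>2\<close>
        of the negated test, so superlevel sets of the power are convex.\<close>
      moreover have "\<rho>2 (\<lambda>\<omega>. (1/2) * - X \<omega> + (1/2) * - Y \<omega>) \<le> 1 / Suc n - s"
        using that XY by (intro sublinear_midpoint[OF assms(2)] neg Lbm)
          (auto simp: A_def conjugate_expectation_def)
      moreover have "(\<lambda>\<omega>. (1/2) * - X \<omega> + (1/2) * - Y \<omega>) = (\<lambda>\<omega>. - ((1/2) * X \<omega> + (1/2) * Y \<omega>))"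
        by (simp add: fun_eq_iff)
      moreover have "(\<lambda>\<omega>. (1/2) * X \<omega> + (1/2) * Y \<omega>) \<in> bounded_measurable M"
        by (intro bounded_measurable_add bounded_measurable_scale Lbm XY)
      moreover have "0 \<le> (1/2) * X \<omega> + (1/2) * Y \<omega> \<and> (1/2) * X \<omega> + (1/2) * Y \<omega> \<le> 1"
        if "\<omega> \<in> space M" for \<omega>
        using L01[OF XY(1) that] L01[OF XY(2) that] by auto
      ultimately show ?thesis
        by (simp add: A_def level_tests_def conjugate_expectation_def)
    qed
  qed blast
  then obtain Y where Y: "\<And>n. Y n \<in> A n" and Cau: "AE \<omega> in K. Cauchy (\<lambda>n. Y n \<omega>)"
    by blast
  have YL: "Y n \<in> ?L" for n using Y[of n] by (simp add: A_def)
  have Ym [measurable]: "Y n \<in> borel_measurable M" for n by (rule Lm[OF YL])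
  have Y1: "\<bar>Y n \<omega>\<bar> \<le> 1" if "\<omega> \<in> space M" for n \<omega> using L01[OF YL that, of n] by simp
  \<comment> \<open>The clipping matters only on the null set where the limit does not exist.\<close>
  define Z where "Z \<omega> = min 1 (max 0 (lim (\<lambda>n. Y n \<omega>)))" for \<omega>
  have Z01: "0 \<le> Z \<omega>" "Z \<omega> \<le> 1" for \<omega> by (auto simp: Z_def)
  have Zbm: "Z \<in> bounded_measurable M"
  proof (rule bounded_measurableI)
    \<comment> \<open>At points of divergence \<open>lim\<close> is one fixed unspecified real, so
      the pointwise limit is measurable on the whole space.\<close>
    show "Z \<in> borel_measurable M" unfolding Z_def by measurable
    show "\<bar>Z \<omega>\<bar> \<le> 1" for \<omega> using Z01[of \<omega>] by simp
  qed
  have lim: "AE \<omega> in K. (\<lambda>n. Y n \<omega>) \<longlonglongrightarrow> Z \<omega>"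
    using Cau
  proof (rule AE_mp, intro AE_I2 impI)
    fix \<omega> assume \<omega>: "\<omega> \<in> space K" and "Cauchy (\<lambda>n. Y n \<omega>)"
    then have l: "(\<lambda>n. Y n \<omega>) \<longlonglongrightarrow> lim (\<lambda>n. Y n \<omega>)"
      using Cauchy_convergent_iff convergent_LIMSEQ_iff by blast
    \<comment> \<open>Where the limit exists it inherits the bounds of the tests, so clipping leaves
      it unchanged.\<close>
    have "0 \<le> lim (\<lambda>n. Y n \<omega>)" "lim (\<lambda>n. Y n \<omega>) \<le> 1"
      using l \<omega> L01[OF YL] by (auto simp: sp intro: LIMSEQ_le_const LIMSEQ_le_const2)
    with l show "(\<lambda>n. Y n \<omega>) \<longlonglongrightarrow> Z \<omega>" by (simp add: Z_def)
  qed
  \<comment> \<open>The size passes to the limit with the constant sequence \<open>\<alpha>\<close>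
    as bounds.\<close>
  have "\<rho>1 Z \<le> \<alpha>"
    by (rule dominated_sup_expectation_limit_le[OF assms(1,6) sets assms(8,10) Ym Y1 Zbm lim _
          tendsto_const]) (use YL in \<open>auto simp: level_tests_def\<close>)
  then have ZL: "Z \<in> ?L" using Z01 Zbm by (simp add: level_tests_def)
  \<comment> \<open>The same limit argument for the negated tests, now with bounds decreasing to
    \<open>- s\<close>, shows that \<open>Z\<close> attains the supremum.\<close>
  have "\<rho>2 (\<lambda>\<omega>. - Z \<omega>) \<le> - s"
  proof (rule dominated_sup_expectation_limit_le[OF assms(2,7) sets assms(9,11)])
    show "(\<lambda>\<omega>. - Y n \<omega>) \<in> borel_measurable M" for n by measurable
    show "\<bar>- Y n \<omega>\<bar> \<le> 1" if "\<omega> \<in> space M" for n \<omega> using Y1[OF that] by simp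
    show "(\<lambda>\<omega>. - Z \<omega>) \<in> bounded_measurable M" by (rule neg[OF Zbm])
    show "AE \<omega> in K. (\<lambda>n. - Y n \<omega>) \<longlonglongrightarrow> - Z \<omega>"
      using lim by eventually_elim (rule tendsto_minus)
    show "\<rho>2 (\<lambda>\<omega>. - Y n \<omega>) \<le> - s + inverse (Suc n)" for n
      using Y[of n] by (simp add: A_def conjugate_expectation_def inverse_eq_divide)
    show "(\<lambda>n. - s + inverse (real (Suc n))) \<longlonglongrightarrow> - s"
      using LIMSEQ_inverse_real_of_nat_add[of "- s"] .
  qed
  then have "s \<le> ?c Z" by (simp add: conjugate_expectation_def)
  moreover have "?c X \<le> s" if "X \<in> ?L" for X
    unfolding s_def using that bdd by (intro cSup_upper) auto
  ultimately show ?thesis using ZL by (meson order_trans)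
qed

end
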